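(* Let $n_v\ge 1$, $N\ge 1$, let $P_1,\dots,P_{n_v}$ be $N\times N$ permutation matrices, and let $$H_2=\begin{bmatrix} I & I&\cdots & I\\ P_1& P_2&\cdots &P_{n_v}\end{bmatrix},\qquad C_{21}=C_{12}^{\mathsf T}=\sum_{i=1}^{n_v}P_i ,$$ where $I$ is the $N\times N$ identity matrix and the sum is taken over $\mathbb Z$. Then $$\mathrm{girth}(H_2)=2\,\mathrm{girth}(C_{12}).$$
   Context: The Tanner graph of a matrix with non-negative integer entries is the bipartite (multi)graph with one check node per row, one variable node per column, and as many edges between check node $a$ and variable node $b$ as the $(a,b)$ entry. $\mathrm{girth}(M)$ is the length of a shortest cycle in the Tanner graph of $M$ ($+\infty$ if there is none); a graph with multiple edges (some entry $\ge 2$) is said to have girth $2$. *)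

theory Defs
  imports "Jordan_Normal_Form.Matrix" "HOL-Library.Extended_Nat"
begin

definition permutation_matrix :: "nat \<Rightarrow> int mat \<Rightarrow> bool" where
  "permutation_matrix N A \<longleftrightarrow>
     A \<in> carrier_mat N N \<and>
     (\<forall>a<N. \<forall>b<N. A $$ (a, b) \<in> {0, 1}) \<and>
     (\<forall>a<N. \<exists>!b. b < N \<and> A $$ (a, b) = 1) \<and>
     (\<forall>b<N. \<exists>!a. a < N \<and> A $$ (a, b) = 1)"

text \<open>
  The Tanner graph is a bipartite multigraph: check node \<open>a\<close> is \<open>Inl a\<close>, variable node \<open>b\<close> is
  \<open>Inr b\<close>, and \<open>(a, b, k)\<close> is the \<open>k\<close>-th of the parallel edges between them.
\<close>

type_synonym tanner_node = "nat + nat"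
type_synonym tanner_edge = "nat \<times> nat \<times> nat"

definition tanner_edges :: "int mat \<Rightarrow> tanner_edge set" where
  "tanner_edges M =
     {(a, b, k). a < dim_row M \<and> b < dim_col M \<and> k < nat (M $$ (a, b))}"

definition tanner_ends :: "tanner_edge \<Rightarrow> tanner_node set" where
  "tanner_ends = (\<lambda>(a, b, k). {Inl a, Inr b})"

text \<open>
  Distinctness of the edges matters only for cycles of length 2, which are exactly the pairs of
  distinct parallel edges; for longer cycles it follows from distinctness of the nodes.
\<close>

definition tanner_cycle :: "int mat \<Rightarrow> tanner_node list \<Rightarrow> tanner_edge list \<Rightarrow> bool" where
  "tanner_cycle M vs es \<longleftrightarrow>
     vs \<noteq> [] \<and> length es = length vs \<and> distinct vs \<and> distinct es \<and>
     set es \<subseteq> tanner_edges M \<and>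
     (\<forall>i<length vs. tanner_ends (es ! i) = {vs ! i, vs ! (Suc i mod length vs)})"

text \<open>The infimum of the empty set in \<^typ>\<open>enat\<close> is \<open>\<infinity>\<close>.\<close>

definition girth :: "int mat \<Rightarrow> enat" where
  "girth M = Inf {enat (length vs) | vs es. tanner_cycle M vs es}"

lemma girth_acyclic: "(\<nexists>vs es. tanner_cycle M vs es) \<Longrightarrow> girth M = \<infinity>"
  by (simp add: girth_def Inf_enat_def)

lemma tanner_cycle_length:
  assumes "tanner_cycle M vs es"
  shows "length vs \<ge> 2"
proof (rule ccontr)
  assume "\<not> length vs \<ge> 2"
  with assms have "length vs = 1"
    by (cases "length vs") (auto simp: tanner_cycle_def)
  with assms have "tanner_ends (es ! 0) = {vs ! 0}"
    by (auto simp: tanner_cycle_def)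
  then show False
    by (cases "es ! 0"; cases "vs ! 0") (auto simp: tanner_ends_def)
qed

lemma girth_multiple_edge:
  assumes "a < dim_row M" "b < dim_col M" "M $$ (a, b) \<ge> 2"
  shows "girth M = 2"
proof (rule antisym)
  have "tanner_cycle M [Inl a, Inr b] [(a, b, 0), (a, b, 1)]"
    using assms
    by (auto simp: tanner_cycle_def tanner_edges_def tanner_ends_def less_Suc_eq)
  then have "enat (length [Inl a, Inr b :: tanner_node]) \<in> {enat (length vs) | vs es. tanner_cycle M vs es}"
    by blast
  then have "girth M \<le> enat (length [Inl a, Inr b :: tanner_node])"
    unfolding girth_def by (rule Inf_lower)
  then show "girth M \<le> 2"
    by (simp add: numeral_eq_enat numeral_2_eq_2)
  show "2 \<le> girth M"
    unfolding girth_def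
    by (rule Inf_greatest) (auto simp: numeral_eq_enat dest: tanner_cycle_length)
qed

text \<open>
  The matrices are \<open>P 1, \<dots>, P nv\<close>; rows and columns are indexed from 0, so column \<open>c\<close> of \<open>H2\<close>
  is column \<open>c mod N\<close> of block column \<open>c div N + 1\<close>.
\<close>

definition H2 :: "nat \<Rightarrow> nat \<Rightarrow> (nat \<Rightarrow> int mat) \<Rightarrow> int mat" where
  "H2 nv N P = mat (2 * N) (nv * N) (\<lambda>(r, c).
     if r < N then 1\<^sub>m N $$ (r, c mod N)
     else P (c div N + 1) $$ (r - N, c mod N))"

definition C21 :: "nat \<Rightarrow> nat \<Rightarrow> (nat \<Rightarrow> int mat) \<Rightarrow> int mat" where
  "C21 nv N P = mat N N (\<lambda>(a, b). \<Sum>i = 1..nv. P i $$ (a, b))"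

definition C12 :: "nat \<Rightarrow> nat \<Rightarrow> (nat \<Rightarrow> int mat) \<Rightarrow> int mat" where
  "C12 nv N P = transpose_mat (C21 nv N P)"

end

(* Every column of H2 has exactly two ones, so the Tanner graph of H2 is the subdivision of the
   multigraph that has the rows as nodes and the columns as edges; subdividing doubles the length
   of every cycle. The column i N + a joins the row a to the row N + b, where b is the row of the
   one in column a of the permutation matrix of its block. Hence the number of columns that join
   a to N + b is the (a, b) entry of C12, and the multigraph is the Tanner graph of C12. *)

theory Submission
  imports Defs
begin

section \<open>Cycles in multigraphs\<close>

text \<open>The pattern of \<open>tanner_cycle\<close> over arbitrary types of nodes and edges, so
  that rows joined by columns form a graph too. Nodes enter only as ends of edges, and a loop would
  count as a cycle of length 1.\<close>

definition mgraph_cycle :: "'e set \<Rightarrow> ('e \<Rightarrow> 'v set) \<Rightarrow> 'v list \<Rightarrow> 'e list \<Rightarrow> bool" where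
  "mgraph_cycle E ends vs es \<longleftrightarrow>
     vs \<noteq> [] \<and> length es = length vs \<and> distinct vs \<and> distinct es \<and> set es \<subseteq> E \<and>
     (\<forall>i<length vs. ends (es ! i) = {vs ! i, vs ! (Suc i mod length vs)})"

definition mgraph_girth :: "'e set \<Rightarrow> ('e \<Rightarrow> 'v set) \<Rightarrow> enat" where
  "mgraph_girth E ends = Inf {enat (length vs) | vs es. mgraph_cycle E ends vs es}"

lemma tanner_cycle_eq: "tanner_cycle M = mgraph_cycle (tanner_edges M) tanner_ends"
  by (auto simp: fun_eq_iff tanner_cycle_def mgraph_cycle_def)

lemma girth_eq: "girth M = mgraph_girth (tanner_edges M) tanner_ends"
  by (simp add: girth_def mgraph_girth_def tanner_cycle_eq)

text \<open>Isolated nodes never lie on a cycle, so a node map that transports cycles has to be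
  injective only on the ends of edges.\<close>

lemma mgraph_cycle_nodes:
  assumes "mgraph_cycle E ends vs es"
  shows "set vs \<subseteq> \<Union> (ends ` E)"
proof
  fix v assume "v \<in> set vs"
  then obtain i where i: "i < length vs" "v = vs ! i"
    by (auto simp: in_set_conv_nth)
  with assms have "es ! i \<in> E" "v \<in> ends (es ! i)"
    by (auto simp: mgraph_cycle_def)
  then show "v \<in> \<Union> (ends ` E)" by blast
qed

lemma mgraph_cycle_map:
  assumes cyc: "mgraph_cycle E ends vs es"
    and f: "inj_on f E" "f ` E \<subseteq> E'"
    and g: "inj_on g (\<Union> (ends ` E))"
    and ends: "\<And>e. e \<in> E \<Longrightarrow> ends' (f e) = g ` ends e"
  shows "mgraph_cycle E' ends' (map g vs) (map f es)"
proof -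
  have "inj_on f (set es)" "inj_on g (set vs)"
    using cyc f(1) g mgraph_cycle_nodes[OF cyc] by (auto simp: mgraph_cycle_def intro: inj_on_subset)
  moreover have "ends' (map f es ! i) = {map g vs ! i, map g vs ! (Suc i mod length vs)}"
    if "i < length vs" for i
  proof -
    have "Suc i mod length vs < length vs" using that by (intro mod_less_divisor) auto
    moreover have "es ! i \<in> E" using cyc that by (auto simp: mgraph_cycle_def)
    ultimately show ?thesis using cyc that by (simp add: mgraph_cycle_def ends)
  qed
  ultimately show ?thesis
    using cyc f(2) by (auto 0 3 simp: mgraph_cycle_def distinct_map)
qed

text \<open>Cycles travel along \<open>f\<close> and \<open>g\<close>, and back along their
  inverses, without change of length. Hence both graphs have the same set of cycle lengths.\<close>

lemma mgraph_girth_iso: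
  assumes f: "bij_betw f E E'"
    and g: "inj_on g (\<Union> (ends ` E))"
    and ends: "\<And>e. e \<in> E \<Longrightarrow> ends' (f e) = g ` ends e"
  shows "mgraph_girth E ends = mgraph_girth E' ends'"
proof -
  let ?f = "the_inv_into E f" and ?V = "\<Union> (ends ` E)"
  let ?g = "the_inv_into ?V g"
  have inv: "bij_betw ?f E' E" by (rule bij_betw_the_inv_into[OF f])
  have img: "\<Union> (ends' ` E') = g ` ?V"
    using ends f by (simp add: bij_betw_def image_UN flip: bij_betw_imp_surj_on[OF f])
  \<comment> \<open>The inverse maps respect ends as well, so \<open>mgraph_cycle_map\<close> also
    applies in the backward direction.\<close>
  have ends_inv: "ends (?f e) = ?g ` ends' e" if "e \<in> E'" for e
  proof -
    have e: "?f e \<in> E" "f (?f e) = e"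
      using that inv f by (auto simp: bij_betw_def f_the_inv_into_f)
    then have "ends' e = g ` ends (?f e)" using ends by metis
    moreover have "?g (g v) = v" if "v \<in> ends (?f e)" for v
      using e(1) that by (intro the_inv_into_f_f[OF g]) blast
    ultimately show ?thesis by (simp add: image_image)
  qed
  have inj: "inj_on f E" "f ` E \<subseteq> E'" "inj_on ?f E'" "?f ` E' \<subseteq> E"
    "inj_on ?g (\<Union> (ends' ` E'))"
    using f inv inj_on_the_inv_into[OF g] by (auto simp: bij_betw_def img)
  have "\<exists>ws fs. length vs = length ws \<and> mgraph_cycle E' ends' ws fs"
    if "mgraph_cycle E ends vs es" for vs es
    using mgraph_cycle_map[OF that inj(1,2) g, of ends'] ends by (metis length_map)
  moreover have "\<exists>ws fs. length vs = length ws \<and> mgraph_cycle E ends ws fs"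
    if "mgraph_cycle E' ends' vs es" for vs es
    using mgraph_cycle_map[OF that inj(3-5), of ends] ends_inv by (metis length_map)
  ultimately have "{enat (length vs) | vs es. mgraph_cycle E ends vs es} =
      {enat (length vs) | vs es. mgraph_cycle E' ends' vs es}"
    by auto
  then show ?thesis by (simp add: mgraph_girth_def)
qed

text \<open>Lets a cycle start one node later; this is how a Tanner cycle is made to begin at a
  check node.\<close>

lemma mgraph_cycle_rotate1:
  assumes "mgraph_cycle E ends vs es"
  shows "mgraph_cycle E ends (rotate1 vs) (rotate1 es)"
proof -
  have "ends (rotate1 es ! i) = {rotate1 vs ! i, rotate1 vs ! (Suc i mod length vs)}"
    if "i < length vs" for i
  proof -
    have "Suc i mod length vs < length vs" using that by (intro mod_less_divisor) auto
    then show ?thesis using assms that by (simp add: mgraph_cycle_def nth_rotate1)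
  qed
  then show ?thesis using assms by (simp add: mgraph_cycle_def)
qed

section \<open>Matrices with two ones in every column\<close>

text \<open>Serves as the ends map of the multigraph on the rows: a column with exactly two ones is
  an edge between the two rows that hold them.\<close>

definition col_support :: "int mat \<Rightarrow> nat \<Rightarrow> nat set" where
  "col_support M c = {r. r < dim_row M \<and> M $$ (r, c) = 1}"

lemma tanner_edges_01:
  assumes "\<And>r c. r < dim_row M \<Longrightarrow> c < dim_col M \<Longrightarrow> M $$ (r, c) \<in> {0, 1}"
  shows "(r, c, k) \<in> tanner_edges M \<longleftrightarrow> c < dim_col M \<and> r \<in> col_support M c \<and> k = 0"
  using assms[of r c] by (auto simp: tanner_edges_def col_support_def)

text \<open>Each edge of the cycle, a column, is replaced by the path of two Tanner edges through
  its variable node.\<close>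

lemma tanner_cycle_subdivide:
  assumes M01: "\<And>r c. r < dim_row M \<Longrightarrow> c < dim_col M \<Longrightarrow> M $$ (r, c) \<in> {0, 1}"
    and card2: "\<And>c. c < dim_col M \<Longrightarrow> card (col_support M c) = 2"
    and cyc: "mgraph_cycle {..<dim_col M} (col_support M) rs cs"
  shows "\<exists>vs es. tanner_cycle M vs es \<and> length vs = 2 * length rs"
proof -
  define L where "L = length rs"
  have L: "L > 0" "length rs = L" "length cs = L" and dist: "distinct rs" "distinct cs"
    and cs: "\<And>i. i < L \<Longrightarrow> cs ! i < dim_col M"
    and supp: "\<And>i. i < L \<Longrightarrow> col_support M (cs ! i) = {rs ! i, rs ! (Suc i mod L)}"
    using cyc unfolding mgraph_cycle_def L_def by (auto simp: subset_iff)
  \<comment> \<open>A support of size 2 excludes loops. This separates the two Tanner edges that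
    meet in the same column.\<close>
  have neq: "rs ! i \<noteq> rs ! (Suc i mod L)" if "i < L" for i
    using card2[OF cs[OF that]] supp[OF that] by auto
  \<comment> \<open>Positions \<open>2 * i\<close> and \<open>Suc (2 * i)\<close> hold the row
    \<open>rs ! i\<close> and the column \<open>cs ! i\<close>. The edges at both positions end in
    that column: the first comes from \<open>rs ! i\<close>, the second goes on to the next
    row.\<close>
  define v :: "nat \<Rightarrow> tanner_node"
    where "v i = (if even i then Inl (rs ! (i div 2)) else Inr (cs ! (i div 2)))" for i
  define e :: "nat \<Rightarrow> tanner_edge"
    where "e i = (if even i then rs ! (i div 2) else rs ! (Suc (i div 2) mod L), cs ! (i div 2), 0)"
    for i
  have half: "i div 2 < L" if "i < 2 * L" for i using that by linarith
  have parity_eqI: "i = j" if "i div 2 = j div 2" "even i = even j" for i j :: nat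
    using that by (metis div_mult_mod_eq parity_cases)
  have "inj_on v {..<2 * L}"
  proof (rule inj_onI)
    fix i j assume ij: "i \<in> {..<2 * L}" "j \<in> {..<2 * L}" and eq: "v i = v j"
    then have "i div 2 < L" "j div 2 < L" using half by auto
    then have "rs ! (i div 2) = rs ! (j div 2) \<longleftrightarrow> i div 2 = j div 2"
      "cs ! (i div 2) = cs ! (j div 2) \<longleftrightarrow> i div 2 = j div 2"
      using dist L by (simp_all add: nth_eq_iff_index_eq)
    then have "i div 2 = j div 2" "even i = even j"
      using eq by (cases "even i"; cases "even j"; simp add: v_def)+
    then show "i = j" by (rule parity_eqI)
  qed
  moreover have "inj_on e {..<2 * L}"
  proof (rule inj_onI)
    fix i j assume ij: "i \<in> {..<2 * L}" "j \<in> {..<2 * L}" and eq: "e i = e j"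
    then have half_lt: "i div 2 < L" "j div 2 < L" using half by auto
    moreover have "cs ! (i div 2) = cs ! (j div 2)" using eq by (simp add: e_def)
    ultimately have "i div 2 = j div 2"
      using dist L by (simp add: nth_eq_iff_index_eq)
    moreover from this have "even i = even j"
      using eq neq[OF half_lt(1)] by (cases "even i"; cases "even j") (auto simp: e_def)
    ultimately show "i = j" by (rule parity_eqI)
  qed
  moreover have "e i \<in> tanner_edges M" if "i < 2 * L" for i
    using half[OF that] cs supp by (auto simp: e_def tanner_edges_01[OF M01])
  moreover have "tanner_ends (e i) = {v i, v (Suc i mod (2 * L))}" if "i < 2 * L" for i
  proof (cases "even i")
    case True
    then have "Suc i < 2 * L" using that by (auto elim: evenE)
    with True show ?thesis by (auto simp: tanner_ends_def e_def v_def)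
  next
    case False
    then have "Suc i = 2 * Suc (i div 2)" by (auto elim!: oddE)
    \<comment> \<open>Only an odd position can wrap around; doubling turns reduction modulo
      \<open>L\<close> into reduction modulo \<open>2 * L\<close>, so the last edge returns to
      \<open>rs ! 0\<close>.\<close>
    then have "Suc i mod (2 * L) = 2 * (Suc (i div 2) mod L)"
      by (simp only: mult_mod_right)
    with False show ?thesis by (auto simp: tanner_ends_def e_def v_def)
  qed
  ultimately have "tanner_cycle M (map v [0..<2 * L]) (map e [0..<2 * L])"
    using L(1) by (auto simp: tanner_cycle_def distinct_map atLeast0LessThan)
  then show ?thesis by (auto simp: L_def intro!: exI)
qed

text \<open>Every edge joins a check node to a variable node, so the sides alternate along the
  cycle. The closing edge leads back to a check node, which forces the last position to be odd and
  the length to be even.\<close>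

lemma tanner_cycle_alternates:
  assumes cyc: "tanner_cycle M vs es" and hd: "isl (vs ! 0)"
  shows "even (length vs)" and "i < length vs \<Longrightarrow> isl (vs ! i) \<longleftrightarrow> even i"
proof -
  have step: "isl (vs ! (Suc i mod length vs)) \<longleftrightarrow> \<not> isl (vs ! i)" if "i < length vs" for i
  proof -
    have "tanner_ends (es ! i) = {vs ! i, vs ! (Suc i mod length vs)}"
      using cyc that by (auto simp: tanner_cycle_def)
    then show ?thesis
      by (cases "es ! i") (auto simp: tanner_ends_def doubleton_eq_iff dest!: sym[of "Inl _"] sym[of "Inr _"])
  qed
  show alt: "isl (vs ! i) \<longleftrightarrow> even i" if "i < length vs" for i
    using that
  proof (induction i)
    case (Suc i)
    then show ?case using step[of i] by simp
  qed (use hd in simp)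
  obtain n where n: "length vs = Suc n"
    using cyc by (cases "length vs") (auto simp: tanner_cycle_def)
  then show "even (length vs)" using step[of n] alt[of n] hd by simp
qed

(* Two consecutive edges that meet in a variable node are distinct, so they lead to distinct
   rows, and these are all the rows in the support of that column. *)
lemma tanner_cycle_contract:
  assumes M01: "\<And>r c. r < dim_row M \<Longrightarrow> c < dim_col M \<Longrightarrow> M $$ (r, c) \<in> {0, 1}"
    and card2: "\<And>c. c < dim_col M \<Longrightarrow> card (col_support M c) = 2"
    and cyc: "tanner_cycle M vs es"
  shows "\<exists>rs cs. mgraph_cycle {..<dim_col M} (col_support M) rs cs \<and> length vs = 2 * length rs"
proof -
  \<comment> \<open>If the cycle starts at a variable node, its second node is a check node, and one
    rotation brings that node to the front.\<close>
  obtain vs' es' where cyc': "tanner_cycle M vs' es'" and hd: "isl (vs' ! 0)"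
    and len: "length vs' = length vs"
  proof (cases "isl (vs ! 0)")
    case True
    with cyc that show ?thesis by blast
  next
    case False
    have ends: "tanner_ends (es ! 0) = {vs ! 0, vs ! (1 mod length vs)}" and "length vs > 0"
      using cyc by (auto simp: tanner_cycle_def)
    obtain a b k where "es ! 0 = (a, b, k)" by (cases "es ! 0")
    with ends have "Inl a \<in> {vs ! 0, vs ! (1 mod length vs)}"
      by (auto simp: tanner_ends_def)
    with False have "isl (vs ! (1 mod length vs))"
      by (metis insert_iff singletonD sum.disc(1))
    moreover have "rotate1 vs ! 0 = vs ! (1 mod length vs)"
      using \<open>length vs > 0\<close> by (simp add: nth_rotate1)
    ultimately show ?thesis
      using that[of "rotate1 vs" "rotate1 es"] mgraph_cycle_rotate1 cyc
      by (metis tanner_cycle_eq length_rotate1)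
  qed
  note alt = tanner_cycle_alternates[OF cyc' hd]
  from alt(1) obtain L where L: "length vs' = 2 * L" by (elim evenE)
  have len_es: "length es' = 2 * L" and dist: "distinct vs'" "distinct es'" and L0: "L > 0"
    and edge: "\<And>i. i < 2 * L \<Longrightarrow> es' ! i \<in> tanner_edges M"
    and ends: "\<And>i. i < 2 * L \<Longrightarrow> tanner_ends (es' ! i) = {vs' ! i, vs' ! (Suc i mod (2 * L))}"
    using cyc' L by (auto simp: tanner_cycle_def intro: Nat.gr0I)
  \<comment> \<open>Rows are read off at even positions and columns at odd ones; alternation
    guarantees that each projection meets the right constructor.\<close>
  define r where "r i = projl (vs' ! (2 * i))" for i
  define c where "c i = projr (vs' ! Suc (2 * i))" for i
  have r: "vs' ! (2 * i) = Inl (r i)" if "i < L" for i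
    using alt(2)[of "2 * i"] that by (simp add: L r_def)
  have c: "vs' ! Suc (2 * i) = Inr (c i)" if "i < L" for i
    using alt(2)[of "Suc (2 * i)"] that by (simp add: L c_def sum.disc_eq_case split: sum.splits)
  have next_lt: "Suc i mod L < L" if "i < L" for i using L0 by simp
  have supp: "c i < dim_col M \<and> col_support M (c i) = {r i, r (Suc i mod L)}" if i: "i < L" for i
  proof -
    let ?j = "Suc i mod L"
    have i2: "2 * i < 2 * L" "Suc (2 * i) < 2 * L" using i by auto
    have "Suc (Suc (2 * i)) mod (2 * L) = 2 * ?j"
      by (simp add: mult_mod_right)
    then have ends': "tanner_ends (es' ! (2 * i)) = {Inl (r i), Inr (c i)}"
      "tanner_ends (es' ! Suc (2 * i)) = {Inr (c i), Inl (r ?j)}"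
      using ends[OF i2(1)] ends[OF i2(2)] i2 r[OF i] c[OF i] r[OF next_lt[OF i]] by simp_all
    obtain a1 b1 k1 where e1: "es' ! (2 * i) = (a1, b1, k1)" by (cases "es' ! (2 * i)")
    obtain a2 b2 k2 where e2: "es' ! Suc (2 * i) = (a2, b2, k2)" by (cases "es' ! Suc (2 * i)")
    have "a1 = r i" "b1 = c i" "a2 = r ?j" "b2 = c i"
      using ends' e1 e2 by (auto simp: tanner_ends_def doubleton_eq_iff)
    \<comment> \<open>Distinctness of edges also settles \<open>L = 1\<close>: there both edges
      would join the same two nodes, and a 0/1 matrix has no parallel edges.\<close>
    moreover have "es' ! (2 * i) \<noteq> es' ! Suc (2 * i)"
      using dist(2) i2 len_es by (simp add: nth_eq_iff_index_eq)
    ultimately have *: "c i < dim_col M" "r i \<in> col_support M (c i)" "r ?j \<in> col_support M (c i)"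
      "r i \<noteq> r ?j"
      using edge[OF i2(1)] edge[OF i2(2)] e1 e2 by (auto simp: tanner_edges_01[OF M01])
    then show ?thesis
      using card2[OF *(1)] by (auto simp: card_2_iff)
  qed
  have "inj_on r {..<L}" "inj_on c {..<L}"
  proof -
    show "inj_on r {..<L}"
    proof (rule inj_onI)
      fix i j assume "i \<in> {..<L}" "j \<in> {..<L}" "r i = r j"
      then have "vs' ! (2 * i) = vs' ! (2 * j)" "i < L" "j < L" by (simp_all add: r)
      then show "i = j" using dist(1) L by (simp add: nth_eq_iff_index_eq)
    qed
    show "inj_on c {..<L}"
    proof (rule inj_onI)
      fix i j assume "i \<in> {..<L}" "j \<in> {..<L}" "c i = c j"
      then have "vs' ! Suc (2 * i) = vs' ! Suc (2 * j)" "i < L" "j < L" by (simp_all add: c)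
      then show "i = j" using dist(1) L by (simp add: nth_eq_iff_index_eq)
    qed
  qed
  then have "mgraph_cycle {..<dim_col M} (col_support M) (map r [0..<L]) (map c [0..<L])"
    using supp L0 next_lt by (auto simp: mgraph_cycle_def distinct_map atLeast0LessThan)
  moreover have "length vs = 2 * length (map r [0..<L])" using len L by simp
  ultimately show ?thesis by blast
qed

text \<open>The least element is doubled; if there is none, both infima are \<infinity>, which
  covers acyclic graphs.\<close>

lemma Inf_enat_double:
  fixes A B :: "nat set"
  assumes "A = (\<lambda>n. 2 * n) ` B"
  shows "Inf (enat ` A) = 2 * Inf (enat ` B)"
proof (cases "B = {}")
  case True
  with assms show ?thesis by (simp add: Inf_enat_def numeral_eq_enat imult_infinity_right)
next
  case False
  define m where "m = (LEAST m. m \<in> B)"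
  have m: "m \<in> B" "\<And>n. n \<in> B \<Longrightarrow> m \<le> n"
    using False by (auto simp: m_def intro: LeastI Least_le)
  have "Inf (enat ` B) = enat m" "Inf (enat ` A) = enat (2 * m)"
    using m by (auto simp: assms intro!: antisym Inf_lower Inf_greatest)
  then show ?thesis by (simp add: numeral_eq_enat)
qed

text \<open>By subdivision and contraction, the Tanner cycle lengths are exactly the doubles of the
  cycle lengths in the multigraph on the rows.\<close>

lemma girth_two_ones_per_column:
  assumes M01: "\<And>r c. r < dim_row M \<Longrightarrow> c < dim_col M \<Longrightarrow> M $$ (r, c) \<in> {0, 1}"
    and card2: "\<And>c. c < dim_col M \<Longrightarrow> card (col_support M c) = 2"
  shows "girth M = 2 * mgraph_girth {..<dim_col M} (col_support M)"
proof -
  let ?A = "{length vs | vs es. tanner_cycle M vs es}"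
  let ?B = "{length rs | rs cs. mgraph_cycle {..<dim_col M} (col_support M) rs cs}"
  have "?A = (\<lambda>n. 2 * n) ` ?B"
  proof
    show "?A \<subseteq> (\<lambda>n. 2 * n) ` ?B"
    proof
      fix n assume "n \<in> ?A"
      then obtain vs es where "n = length vs" "tanner_cycle M vs es" by blast
      then show "n \<in> (\<lambda>n. 2 * n) ` ?B"
        using tanner_cycle_contract[OF M01 card2, of vs es] by blast
    qed
    show "(\<lambda>n. 2 * n) ` ?B \<subseteq> ?A"
    proof
      fix n assume "n \<in> (\<lambda>n. 2 * n) ` ?B"
      then obtain rs cs where "n = 2 * length rs"
        "mgraph_cycle {..<dim_col M} (col_support M) rs cs" by blast
      then show "n \<in> ?A"
        using tanner_cycle_subdivide[OF M01 card2, of rs cs] by force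
    qed
  qed
  then have "Inf (enat ` ?A) = 2 * Inf (enat ` ?B)" by (rule Inf_enat_double)
  moreover have "enat ` ?A = {enat (length vs) | vs es. tanner_cycle M vs es}"
    "enat ` ?B = {enat (length rs) | rs cs. mgraph_cycle {..<dim_col M} (col_support M) rs cs}"
    by blast+
  ultimately show ?thesis by (simp add: girth_def mgraph_girth_def)
qed

section \<open>The columns of \<open>H2\<close>\<close>

context
  fixes nv N :: nat and P :: "nat \<Rightarrow> int mat"
  assumes N: "N \<ge> 1" and perm: "\<And>i. i \<in> {1..nv} \<Longrightarrow> permutation_matrix N (P i)"
begin

lemma block_index: "c < nv * N \<Longrightarrow> c div N + 1 \<in> {1..nv}"
  using N by (auto simp: less_mult_imp_div_less Suc_le_eq)

lemma dim_H2: "dim_row (H2 nv N P) = 2 * N" "dim_col (H2 nv N P) = nv * N"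
  by (simp_all add: H2_def)

lemma H2_entry:
  assumes "r < 2 * N" "c < nv * N"
  shows "H2 nv N P $$ (r, c) =
    (if r < N then if r = c mod N then 1 else 0 else P (c div N + 1) $$ (r - N, c mod N))"
  using assms N by (simp add: H2_def)

lemma H2_01:
  assumes "r < dim_row (H2 nv N P)" "c < dim_col (H2 nv N P)"
  shows "H2 nv N P $$ (r, c) \<in> {0, 1}"
proof -
  have "c mod N < N" using N by simp
  then show ?thesis
    using assms perm[OF block_index[of c]] unfolding dim_H2
    by (subst H2_entry) (auto simp: permutation_matrix_def)
qed

text \<open>The identity block contributes the row \<open>c mod N\<close>; the permutation matrix
  below contributes the one row in which its column \<open>c mod N\<close> has its one, shifted by
  \<open>N\<close>.\<close>

lemma H2_support_iff:
  assumes "c < nv * N" "a < N" "b < N"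
  shows "col_support (H2 nv N P) c = {a, N + b} \<longleftrightarrow> c mod N = a \<and> P (c div N + 1) $$ (b, a) = 1"
proof -
  have cN: "c mod N < N" using N by simp
  have "\<exists>!b. b < N \<and> P (c div N + 1) $$ (b, c mod N) = 1"
    using perm[OF block_index[OF assms(1)]] cN by (auto simp: permutation_matrix_def)
  then obtain b' where b': "b' < N" "P (c div N + 1) $$ (b', c mod N) = 1"
    "\<And>x. x < N \<Longrightarrow> P (c div N + 1) $$ (x, c mod N) = 1 \<Longrightarrow> x = b'" by blast
  have "r \<in> col_support (H2 nv N P) c \<longleftrightarrow> r = c mod N \<or> r = N + b'" for r
  proof (cases "r < N")
    case True
    then show ?thesis using assms(1) by (simp add: col_support_def dim_H2 H2_entry)
  next
    case False
    have "r \<in> col_support (H2 nv N P) c \<longleftrightarrow>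
        r < 2 * N \<and> P (c div N + 1) $$ (r - N, c mod N) = 1"
      using False assms(1) by (auto simp: col_support_def dim_H2 H2_entry)
    also have "\<dots> \<longleftrightarrow> r - N < N \<and> P (c div N + 1) $$ (r - N, c mod N) = 1"
      using False N by auto
    also have "\<dots> \<longleftrightarrow> r - N = b'" using b' by blast
    finally show ?thesis using False cN by auto
  qed
  then have "col_support (H2 nv N P) c = {c mod N, N + b'}" by blast
  \<comment> \<open>One element lies below \<open>N\<close> and the other does not, so the unordered
    pair determines \<open>a\<close> and \<open>b\<close>.\<close>
  moreover have "{c mod N, N + b'} = {a, N + b} \<longleftrightarrow> c mod N = a \<and> b' = b"
    using assms(2) cN by (simp add: doubleton_eq_iff)
  ultimately show ?thesis using b' assms(3) by metis
qed

lemma H2_support_ex: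
  assumes "c < nv * N"
  obtains a b where "a < N" "b < N" "col_support (H2 nv N P) c = {a, N + b}"
proof -
  have "c mod N < N" using N by simp
  moreover from this obtain b where "b < N" "P (c div N + 1) $$ (b, c mod N) = 1"
    using perm[OF block_index[OF assms]] by (auto simp: permutation_matrix_def)
  ultimately show ?thesis using that H2_support_iff[OF assms] by blast
qed

lemma card_H2_support: "c < dim_col (H2 nv N P) \<Longrightarrow> card (col_support (H2 nv N P) c) = 2"
  unfolding dim_H2 by (erule H2_support_ex) simp

text \<open>Because of the transposition, the entry counts the blocks \<open>i\<close> with a one of
  \<open>P i\<close> at \<open>(b, a)\<close>. Each such block contains exactly one column that
  joins \<open>a\<close> to \<open>N + b\<close>, namely the one at offset \<open>a\<close>.\<close>

lemma C12_entry:
  assumes "a < N" "b < N"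
  shows "C12 nv N P $$ (a, b) = int (card {c. c < nv * N \<and> col_support (H2 nv N P) c = {a, N + b}})"
proof -
  let ?I = "{i \<in> {1..nv}. P i $$ (b, a) = 1}"
  have "C12 nv N P $$ (a, b) = (\<Sum>i = 1..nv. P i $$ (b, a))"
    using assms by (simp add: C12_def C21_def)
  also have "\<dots> = (\<Sum>i = 1..nv. if P i $$ (b, a) = 1 then 1 else 0)"
  proof (rule sum.cong)
    fix i assume "i \<in> {1..nv}"
    then have "P i $$ (b, a) \<in> {0, 1}"
      using perm assms by (auto simp: permutation_matrix_def)
    then show "P i $$ (b, a) = (if P i $$ (b, a) = 1 then 1 else 0)" by auto
  qed simp
  also have "\<dots> = int (card ?I)"
    by (simp add: sum.If_cases Int_def)
  also have "card ?I = card {c. c < nv * N \<and> c mod N = a \<and> P (c div N + 1) $$ (b, a) = 1}"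
  proof (rule bij_betw_same_card, rule bij_betwI)
    \<comment> \<open>Blocks are numbered from 1 but columns from 0, hence \<open>i - 1\<close> here
      and \<open>c div N + 1\<close> in the inverse.\<close>
    show "(\<lambda>i. (i - 1) * N + a) \<in> ?I \<rightarrow> {c. c < nv * N \<and> c mod N = a \<and> P (c div N + 1) $$ (b, a) = 1}"
    proof
      fix i assume i: "i \<in> ?I"
      then have "i * N \<le> nv * N" "i * N = (i - 1) * N + N"
        by (auto simp: algebra_simps diff_mult_distrib)
      then have "(i - 1) * N + a < nv * N" using assms by linarith
      then show "(i - 1) * N + a \<in> {c. c < nv * N \<and> c mod N = a \<and> P (c div N + 1) $$ (b, a) = 1}"
        using i assms by auto
    qed
    show "(\<lambda>c. c div N + 1) \<in> {c. c < nv * N \<and> c mod N = a \<and> P (c div N + 1) $$ (b, a) = 1} \<rightarrow> ?I"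
      using block_index by auto
  qed (use assms in auto)
  also have "{c. c < nv * N \<and> c mod N = a \<and> P (c div N + 1) $$ (b, a) = 1} =
      {c. c < nv * N \<and> col_support (H2 nv N P) c = {a, N + b}}"
    using H2_support_iff[of _ a b] assms by blast
  finally show ?thesis .
qed

text \<open>The Tanner graph of \<open>C12\<close> is isomorphic, up to isolated nodes, to the
  multigraph of rows and columns of \<open>H2\<close>: the multiplicity of an edge is the number of
  columns that join the corresponding rows.\<close>

lemma girth_C12: "girth (C12 nv N P) = mgraph_girth {..<nv * N} (col_support (H2 nv N P))"
proof -
  let ?S = "col_support (H2 nv N P)"
  define cell where "cell a b = {c. c < nv * N \<and> ?S c = {a, N + b}}" for a b
  \<comment> \<open>Any enumeration of a cell will do: the \<open>k\<close>-th parallel edge between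
    \<open>a\<close> and \<open>b\<close> is matched with the \<open>k\<close>-th column in
    it.\<close>
  have "\<exists>h. bij_betw h {..<card (cell a b)} (cell a b)" for a b
    using ex_bij_betw_nat_finite[of "cell a b"] by (simp add: cell_def atLeast0LessThan)
  then obtain h where h: "\<And>a b. bij_betw (h a b) {..<card (cell a b)} (cell a b)" by metis
  have edges: "(a, b, k) \<in> tanner_edges (C12 nv N P) \<longleftrightarrow> a < N \<and> b < N \<and> k < card (cell a b)"
    for a b k
  proof -
    have "dim_row (C12 nv N P) = N" "dim_col (C12 nv N P) = N" by (simp_all add: C12_def C21_def)
    then show ?thesis by (auto simp: tanner_edges_def C12_entry cell_def)
  qed
  define f :: "tanner_edge \<Rightarrow> nat" where "f = (\<lambda>(a, b, k). h a b k)"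
  \<comment> \<open>Check nodes go to the upper rows and variable nodes to the lower rows. The map
    is injective on the ends of edges, where the check indices stay below \<open>N\<close>.\<close>
  define g :: "tanner_node \<Rightarrow> nat" where "g = case_sum (\<lambda>a. a) (\<lambda>b. N + b)"
  have h_cell: "h a b k \<in> cell a b" if "k < card (cell a b)" for a b k
    using h[of a b] that by (auto simp: bij_betw_def)
  have "inj_on f (tanner_edges (C12 nv N P))"
  proof (rule inj_onI)
    fix e e'
    assume e: "e \<in> tanner_edges (C12 nv N P)" "e' \<in> tanner_edges (C12 nv N P)" "f e = f e'"
    obtain a b k a' b' k' where abk: "e = (a, b, k)" "e' = (a', b', k')"
      by (cases e, cases e')
    have "f e \<in> cell a b" "f e' \<in> cell a' b'"
      using e(1,2) by (auto simp: abk edges f_def intro: h_cell)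
    \<comment> \<open>A column has only one support, so it lies in the cell of only one pair
      \<open>a\<close>, \<open>b\<close>; within a cell the enumeration is injective.\<close>
    then have "{a, N + b} = {a', N + b'}" using e(3) by (auto simp: cell_def)
    then have eq: "a = a'" "b = b'" using e(1,2) by (auto simp: abk edges doubleton_eq_iff)
    moreover have "inj_on (h a b) {..<card (cell a b)}"
      using h by (simp add: bij_betw_def)
    then have "k = k'"
      by (rule inj_onD) (use e eq in \<open>auto simp: abk edges f_def\<close>)
    ultimately show "e = e'" by (simp add: abk)
  qed
  moreover have "f ` tanner_edges (C12 nv N P) = {..<nv * N}"
  proof
    show "f ` tanner_edges (C12 nv N P) \<subseteq> {..<nv * N}"
      using h_cell by (auto simp: f_def edges cell_def)
    show "{..<nv * N} \<subseteq> f ` tanner_edges (C12 nv N P)"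
    proof
      fix c assume "c \<in> {..<nv * N}"
      \<comment> \<open>Surjectivity: every column joins an upper row to a lower row and hence lies
        in some cell.\<close>
      then obtain a b where ab: "a < N" "b < N" "c \<in> cell a b"
        by (auto simp: cell_def elim: H2_support_ex)
      then obtain k where "k < card (cell a b)" "c = h a b k"
        using h[of a b] by (auto simp: bij_betw_def)
      with ab have "(a, b, k) \<in> tanner_edges (C12 nv N P)" "c = f (a, b, k)"
        by (auto simp: edges f_def)
      then show "c \<in> f ` tanner_edges (C12 nv N P)" by blast
    qed
  qed
  ultimately have "bij_betw f (tanner_edges (C12 nv N P)) {..<nv * N}"
    by (simp add: bij_betw_def)
  moreover have "inj_on g (\<Union> (tanner_ends ` tanner_edges (C12 nv N P)))"
    by (rule inj_onI) (auto simp: g_def tanner_ends_def edges)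
  moreover have "?S (f e) = g ` tanner_ends e" if "e \<in> tanner_edges (C12 nv N P)" for e
    using that h_cell by (cases e) (auto simp: edges f_def g_def tanner_ends_def cell_def)
  ultimately show ?thesis
    unfolding girth_eq by (rule mgraph_girth_iso)
qed

end

theorem theorem18:
  fixes nv N :: nat and P :: "nat \<Rightarrow> int mat"
  assumes "nv \<ge> 1" and "N \<ge> 1"
    and "\<And>i. i \<in> {1..nv} \<Longrightarrow> permutation_matrix N (P i)"
  shows "girth (H2 nv N P) = 2 * girth (C12 nv N P)"
proof -
  have "girth (H2 nv N P) =
      2 * mgraph_girth {..<dim_col (H2 nv N P)} (col_support (H2 nv N P))"
    using assms(2,3) by (intro girth_two_ones_per_column H2_01 card_H2_support)
  then show ?thesis
    using girth_C12[of N nv P] assms(2,3) by (simp add: H2_def)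
qed

end
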